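(* Let $M$ be an $m\times n$ matrix with all entries in $[-1,1]$, and let $f:[-1,1]\to[0,1]$ be a function. Let $X$ be a random $m\times n$ matrix with independent entries in $[-1,1]$ such that $\mathbb{E}(x_{ij})=m_{ij}$ for each $i$ and $j$. The $(i,j)$-th entry of $X$ is revealed with probability $f(m_{ij})$ and remains hidden with probability $1-f(m_{ij})$, and these events occur independently. Let $\hat M$ be an estimator of $M$, and for a positive integer $b$ let $\hat f^b$ be the estimator of $f$ based on $\hat M$ defined in the context. Suppose that $f$ is Lipschitz, with Lipschitz constant $L$. Let $\mu$ be the empirical distribution of the entries of $M$ and let $$\theta:=\mathrm{MSE}(\hat M)=\mathbb{E}\Bigl[\frac1{mn}\sum_{i=1}^m\sum_{j=1}^n(\hat m_{ij}-m_{ij})^2\Bigr].$$ Then $$\int\bigl(\hat f^b(x)-f(x)\bigr)^2\,d\mu(x)\le C\theta^{1/3}b^{5/3}+\frac{Cb}{mn}+\frac{CL^2}{b^2},$$ where $C$ is a universal constant.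
   Context: Here $m_{ij}$, $\hat m_{ij}$, $x_{ij}$ denote the $(i,j)$-th entries of $M$, $\hat M$, $X$. An entry of $M$ is called revealed if the corresponding entry of $X$ is revealed. Definition of $\hat f^b$, where $b$ is a positive integer chosen by the user: 1. For $i=1,\dots,2b+3$, let $c_i:=-1+(i-2)b^{-1}$ (equally spaced points from $-1-b^{-1}$ to $1+b^{-1}$). 2. For each $i$, choose $a_i$ uniformly at random from the interval $[c_i-(4b)^{-1},c_i+(4b)^{-1}]$. 3. In the interval $[a_i,a_{i+1}]$, define $\hat f^b$ to be the proportion of revealed entries among those entries of $M$ such that the corresponding entry of $\hat M$ is in $[a_i,a_{i+1}]$ (the proportion is taken to be $0$ if there are no such entries). This defines $\hat f^b$ on an interval slightly larger than $[-1,1]$; its domain can then be restricted to $[-1,1]$.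
   Formalization: The left side is bounded in expectation (for f=1/2, M and its estimator 0, b=1, the pointwise bound fails with positive probability when mn is large); θ is assumed finite, and the sample space is one fixed function space, which loses nothing since only the joint law matters. *)

theory Defs
  imports "HOL-Probability.Probability"
begin

definition idx :: "nat \<Rightarrow> nat \<Rightarrow> (nat \<times> nat) set" where
  "idx m n = {1..m} \<times> {1..n}"

(* The law of a uniformly chosen entry of the m x n matrix M; only used for m, n >= 1. *)
definition empirical_dist :: "nat \<Rightarrow> nat \<Rightarrow> (nat \<Rightarrow> nat \<Rightarrow> real) \<Rightarrow> real pmf" where
  "empirical_dist m n M = map_pmf (\<lambda>(i, j). M i j) (pmf_of_set (idx m n))"

(* The primitive sources of randomness: the entries of X, the revealing events, the random
   breakpoints a_k, and a seed that allows the estimator of M to be randomized. *)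
datatype source = Entry nat nat | Reveal nat nat | Breakpoint nat | Seed

definition sources :: "nat \<Rightarrow> nat \<Rightarrow> nat \<Rightarrow> source set" where
  "sources m n b = {Entry i j |i j. (i, j) \<in> idx m n} \<union> {Reveal i j |i j. (i, j) \<in> idx m n}
     \<union> {Breakpoint k |k. k \<in> {1..2 * b + 3}} \<union> {Seed}"

primrec source_var ::
  "(nat \<Rightarrow> nat \<Rightarrow> 'w \<Rightarrow> real) \<Rightarrow> (nat \<Rightarrow> nat \<Rightarrow> 'w set) \<Rightarrow> (nat \<Rightarrow> 'w \<Rightarrow> real) \<Rightarrow> ('w \<Rightarrow> real)
     \<Rightarrow> source \<Rightarrow> 'w \<Rightarrow> real" where
  "source_var X Rev a U (Entry i j) = X i j"
| "source_var X Rev a U (Reveal i j) = indicator (Rev i j)"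
| "source_var X Rev a U (Breakpoint k) = a k"
| "source_var X Rev a U Seed = U"

definition grid_point :: "nat \<Rightarrow> nat \<Rightarrow> real" where
  "grid_point b k = -1 + (real k - 2) / real b"

(* Rev i j is the event that the (i,j)-th entry is revealed. The entries, the revealing events,
   the breakpoints and the seed are jointly independent; the law of the seed is arbitrary. *)
definition sampling_model ::
  "'w measure \<Rightarrow> nat \<Rightarrow> nat \<Rightarrow> nat \<Rightarrow> (nat \<Rightarrow> nat \<Rightarrow> real) \<Rightarrow> (real \<Rightarrow> real)
     \<Rightarrow> (nat \<Rightarrow> nat \<Rightarrow> 'w \<Rightarrow> real) \<Rightarrow> (nat \<Rightarrow> nat \<Rightarrow> 'w set) \<Rightarrow> (nat \<Rightarrow> 'w \<Rightarrow> real) \<Rightarrow> ('w \<Rightarrow> real) \<Rightarrow> bool" where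
  "sampling_model P m n b M f X Rev a U \<longleftrightarrow>
     prob_space P \<and>
     prob_space.indep_vars P (\<lambda>_. borel) (source_var X Rev a U) (sources m n b) \<and>
     (\<forall>(i, j)\<in>idx m n.
        (AE \<omega> in P. X i j \<omega> \<in> {-1..1}) \<and> integral\<^sup>L P (X i j) = M i j \<and>
        Rev i j \<in> sets P \<and> measure P (Rev i j) = f (M i j)) \<and>
     (\<forall>k\<in>{1..2 * b + 3}. distr P borel (a k) =
        uniform_measure lborel {grid_point b k - 1 / (4 * real b)..grid_point b k + 1 / (4 * real b)})"

(* What the statistician sees: for each entry whether it is revealed (1 or 0), and its value if
   so. The value component is 0 at a hidden entry, hence carries no information there. *)
definition observed ::
  "nat \<Rightarrow> nat \<Rightarrow> (nat \<Rightarrow> nat \<Rightarrow> 'w \<Rightarrow> real) \<Rightarrow> (nat \<Rightarrow> nat \<Rightarrow> 'w set) \<Rightarrow> 'w \<Rightarrow> nat \<times> nat \<Rightarrow> real \<times> real" where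
  "observed m n X Rev \<omega> =
     (\<lambda>(i, j)\<in>idx m n. (indicator (Rev i j) \<omega>, indicator (Rev i j) \<omega> * X i j \<omega>))"

(* An estimator is a measurable function of the observed data and of the seed; it is an ordinary
   non-randomized estimator if it ignores the seed. *)
definition is_estimator ::
  "nat \<Rightarrow> nat \<Rightarrow> ((nat \<times> nat \<Rightarrow> real \<times> real) \<times> real \<Rightarrow> nat \<Rightarrow> nat \<Rightarrow> real) \<Rightarrow> bool" where
  "is_estimator m n T \<longleftrightarrow>
     (\<forall>(i, j)\<in>idx m n. (\<lambda>z. T z i j) \<in> borel_measurable ((\<Pi>\<^sub>M _\<in>idx m n. borel) \<Otimes>\<^sub>M borel))"

definition MSE :: "'w measure \<Rightarrow> nat \<Rightarrow> nat \<Rightarrow> (nat \<Rightarrow> nat \<Rightarrow> real) \<Rightarrow> ('w \<Rightarrow> nat \<Rightarrow> nat \<Rightarrow> real) \<Rightarrow> real" where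
  "MSE P m n M Mhat =
     (\<integral>\<omega>. 1 / (real m * real n) * (\<Sum>i=1..m. \<Sum>j=1..n. (Mhat \<omega> i j - M i j)\<^sup>2) \<partial>P)"

(* H is a realization of the estimator of M, S the set of revealed positions. *)
definition revealed_proportion ::
  "nat \<Rightarrow> nat \<Rightarrow> (nat \<times> nat) set \<Rightarrow> (nat \<Rightarrow> nat \<Rightarrow> real) \<Rightarrow> real set \<Rightarrow> real" where
  "revealed_proportion m n S H I =
     (let B = {(i, j) \<in> idx m n. H i j \<in> I}
      in if B = {} then 0 else real (card (B \<inter> S)) / real (card B))"

(* A breakpoint a_k (1 < k < 2b+3) belongs to two of the closed intervals; there the value of the
   left one is taken. Almost surely no breakpoint is an entry of M, so this choice does not affect
   the integral against the empirical distribution. Almost surely the intervals cover [-1,1]; off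
   their union the value is irrelevant. *)
definition fhat ::
  "nat \<Rightarrow> nat \<Rightarrow> nat \<Rightarrow> (nat \<Rightarrow> real) \<Rightarrow> (nat \<times> nat) set \<Rightarrow> (nat \<Rightarrow> nat \<Rightarrow> real) \<Rightarrow> real \<Rightarrow> real" where
  "fhat b m n a S H x =
     (let k = (LEAST k. k \<in> {1..2 * b + 2} \<and> x \<in> {a k..a (Suc k)})
      in revealed_proportion m n S H {a k..a (Suc k)})"

end

theory Submission imports Defs begin

text \<open>
  Group the positions by the bin containing the entry of \<open>M\<close>, and compare the revealed proportion of
  the bin of \<open>Mhat\<close> first with the proportion of the bin of \<open>M\<close>, then with the mean of \<open>f\<close> over the
  latter, then with \<open>f\<close> itself. The last step costs the Lipschitz constant times the bin width. In
  the second, the bins of \<open>M\<close> depend on the breakpoints only, which are independent of the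
  revealing events; so the cross terms have mean zero and every bin costs a constant. In the first,
  the two bins differ only at bad positions: those where \<open>Mhat\<close> is off by more than \<open>\<delta>\<close>, whose
  expected proportion is at most \<open>\<theta> / \<delta>\<^sup>2\<close> by Markov, or those where a breakpoint is within
  \<open>\<delta>\<close> of the entry of \<open>M\<close>, which has probability at most \<open>4 * b * \<delta>\<close> since the windows of the breakpoints are
  disjoint. Counting all bad positions once for each bin costs a further factor of order \<open>b\<close>. As
  neither bound uses how \<open>Mhat\<close> depends on the data, no independence is needed there.
\<close>

section \<open>Deterministic error bounds for bins\<close>

text \<open>With \<open>F\<close> the mean of \<open>f\<close> over \<open>B\<close>, the error is
  \<open>u + v + (F - f p)\<close>: the change of proportion from \<open>A\<close> to
  \<open>B\<close>, the fluctuation of the revealed proportion in \<open>B\<close>, and the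
  oscillation of \<open>f\<close>. The factor 3 is the price of squaring a sum of three
  terms.\<close>

lemma proportion_error:
  fixes f :: "'i \<Rightarrow> real"
  defines "prop \<equiv> \<lambda>A S. if A = {} then 0 else real (card (A \<inter> S)) / real (card A)"
  assumes fin: "finite A" "finite B" and "B \<noteq> {}"
    and f: "\<And>p q. p \<in> B \<Longrightarrow> q \<in> B \<Longrightarrow> \<bar>f p - f q\<bar> \<le> \<epsilon>"
  shows "(\<Sum>p\<in>B. (prop A S - f p)\<^sup>2)
    \<le> 6 * real (card ((A - B) \<union> (B - A)))
       + 3 / real (card B) * (\<Sum>p\<in>B. indicator S p - f p)\<^sup>2 + 3 * real (card B) * \<epsilon>\<^sup>2"
proof -
  define D where "D = (A - B) \<union> (B - A)"
  define N where "N = real (card B)"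
  define F where "F = (\<Sum>p\<in>B. f p) / N"
  define u where "u = prop A S - prop B S"
  define v where "v = (\<Sum>p\<in>B. indicator S p - f p) / N"
  have N: "N > 0"
    using assms by (simp add: N_def card_gt_0_iff)
  have prop01: "0 \<le> prop A S" "prop A S \<le> 1" for A :: "'i set"
    unfolding prop_def by (auto simp: divide_simps intro!: card_mono dest: card_ge_0_finite)
  have finD: "finite D"
    using fin by (simp add: D_def)
  have sdiff: "\<bar>real (card P) - real (card Q)\<bar> \<le> real (card D)"
    if "finite P" "finite Q" "P - Q \<subseteq> D" "Q - P \<subseteq> D" for P Q
  proof -
    have "card P \<le> card (Q \<union> D)" "card Q \<le> card (P \<union> D)"
      using that finD by (auto intro!: card_mono)
    moreover have "card (Q \<union> D) \<le> card Q + card D" "card (P \<union> D) \<le> card P + card D"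
      by (rule card_Un_le)+
    ultimately show ?thesis by linarith
  qed
  have "\<bar>N - real (card A)\<bar> \<le> card D" "\<bar>real (card (A \<inter> S)) - real (card (B \<inter> S))\<bar> \<le> card D"
    unfolding N_def using fin sdiff[of B A] sdiff[of "A \<inter> S" "B \<inter> S"] by (auto simp: D_def)
  \<comment> \<open>Weighting the difference of the cardinalities by the proportion of
    \<open>A\<close> itself avoids any lower bound on the size of \<open>A\<close>. The default
    value 0 makes the identity hold for empty \<open>A\<close> too.\<close>
  moreover have "N * u = (N - real (card A)) * prop A S + (real (card (A \<inter> S)) - real (card (B \<inter> S)))"
    using fin N assms(4) by (auto simp: u_def prop_def N_def field_simps)
  moreover have "\<bar>(N - real (card A)) * prop A S\<bar> \<le> \<bar>N - real (card A)\<bar>"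
    using prop01[of A] by (simp add: abs_mult mult_left_le)
  ultimately have "\<bar>N * u\<bar> \<le> 2 * card D" by linarith
  moreover have "\<bar>u\<bar> \<le> 1"
    using prop01[of A] prop01[of B] by (simp add: u_def)
  then have "u\<^sup>2 \<le> \<bar>u\<bar>"
    using mult_left_le[of "\<bar>u\<bar>" "\<bar>u\<bar>"] by (simp add: power2_eq_square)
  then have "N * u\<^sup>2 \<le> \<bar>N * u\<bar>"
    using N by (simp add: abs_mult)
  ultimately have *: "N * u\<^sup>2 \<le> 2 * card D" by linarith
  have "prop B S = (\<Sum>p\<in>B. indicator S p) / N"
    using fin assms(4) by (simp add: prop_def N_def indicator_def)
  then have v: "v = prop B S - F"
    by (simp add: v_def F_def sum_subtractf diff_divide_distrib)
  have F: "\<bar>F - f p\<bar> \<le> \<epsilon>" if "p \<in> B" for p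
  proof -
    have "\<bar>\<Sum>q\<in>B. f q - f p\<bar> \<le> (\<Sum>q\<in>B. \<epsilon>)"
      by (rule order_trans[OF sum_abs sum_mono]) (rule f[OF _ that])
    moreover have "F - f p = (\<Sum>q\<in>B. f q - f p) / N"
      using N by (simp add: F_def sum_subtractf N_def field_simps)
    ultimately show ?thesis
      using N by (simp add: N_def abs_divide divide_le_eq mult.commute)
  qed
  have "(\<Sum>p\<in>B. (prop A S - f p)\<^sup>2) \<le> (\<Sum>p\<in>B. 3 * u\<^sup>2 + 3 * v\<^sup>2 + 3 * \<epsilon>\<^sup>2)"
  proof (rule sum_mono)
    fix p assume p: "p \<in> B"
    have e: "(F - f p)\<^sup>2 \<le> \<epsilon>\<^sup>2"
      using power_mono[OF F[OF p], of 2] by simp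
    have "(prop A S - f p)\<^sup>2 = (u + v + (F - f p))\<^sup>2"
      by (simp add: u_def v)
    also have "\<dots> \<le> 3 * u\<^sup>2 + 3 * v\<^sup>2 + 3 * (F - f p)\<^sup>2"
      \<comment> \<open>The difference of the two sides is the sum of the squares of the three
        pairwise differences.\<close>
      using sum_squares_ge_zero[of "u - v" "v - (F - f p)"] zero_le_power2[of "u - (F - f p)"]
      by (simp add: power2_eq_square algebra_simps)
    finally show "(prop A S - f p)\<^sup>2 \<le> 3 * u\<^sup>2 + 3 * v\<^sup>2 + 3 * \<epsilon>\<^sup>2"
      using e by linarith
  qed
  also have "\<dots> = 3 * (N * u\<^sup>2) + 3 / N * (\<Sum>p\<in>B. indicator S p - f p)\<^sup>2 + 3 * N * \<epsilon>\<^sup>2"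
    using N by (simp add: N_def[symmetric] v_def field_simps power2_eq_square)
  finally show ?thesis
    using * by (simp add: D_def N_def)
qed

text \<open>Separates the diagonal, which is bounded for every outcome, from the cross terms, which
  have mean zero.\<close>

lemma sum_square_split:
  fixes r :: "'i \<Rightarrow> real"
  assumes "finite B"
  shows "(\<Sum>p\<in>B. r p)\<^sup>2 = (\<Sum>p\<in>B. (r p)\<^sup>2) + (\<Sum>p\<in>B. \<Sum>q\<in>B - {p}. r p * r q)"
proof -
  have "(\<Sum>p\<in>B. r p)\<^sup>2 = (\<Sum>p\<in>B. \<Sum>q\<in>B. r p * r q)"
    by (simp add: power2_eq_square sum_product)
  also have "\<dots> = (\<Sum>p\<in>B. (r p)\<^sup>2 + (\<Sum>q\<in>B - {p}. r p * r q))"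
    using assms by (intro sum.cong refl) (simp add: sum.remove power2_eq_square)
  finally show ?thesis by (simp add: sum.distrib)
qed

text \<open>Carries all dependence on the bins, so that the cross terms of all bins become one sum
  over index sets that are not random, through which the expectation can pass.\<close>

definition same_bin_weight :: "'i set \<Rightarrow> ('i \<Rightarrow> nat) \<Rightarrow> 'i \<Rightarrow> 'i \<Rightarrow> real" where
  "same_bin_weight V \<kappa> p q = (if \<kappa> q = \<kappa> p then 1 / real (card {r \<in> V. \<kappa> r = \<kappa> p}) else 0)"

text \<open>Sums \<open>proportion_error\<close> over the nonempty bins. The cross terms are kept
  exactly, because they are small only in expectation.\<close>

lemma binned_error:
  fixes f :: "'i \<Rightarrow> real" and \<kappa> :: "'i \<Rightarrow> nat"
  defines "prop \<equiv> \<lambda>A S. if A = {} then 0 else real (card (A \<inter> S)) / real (card A)"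
  assumes fin: "finite V" "finite K" "\<And>k. k \<in> K \<Longrightarrow> finite (A k)" and K: "\<kappa> ` V \<subseteq> K"
    and D: "\<And>k. k \<in> K \<Longrightarrow> real (card ((A k - {p \<in> V. \<kappa> p = k}) \<union> ({p \<in> V. \<kappa> p = k} - A k))) \<le> D"
    and "0 \<le> D" and f01: "\<And>p. p \<in> V \<Longrightarrow> f p \<in> {0..1}"
    and f: "\<And>p q. p \<in> V \<Longrightarrow> q \<in> V \<Longrightarrow> \<kappa> p = \<kappa> q \<Longrightarrow> \<bar>f p - f q\<bar> \<le> \<epsilon>"
  shows "(\<Sum>p\<in>V. (prop (A (\<kappa> p)) S - f p)\<^sup>2)
    \<le> real (card K) * (6 * D + 3)
       + 3 * (\<Sum>p\<in>V. \<Sum>q\<in>V - {p}. same_bin_weight V \<kappa> p q * ((indicator S p - f p) * (indicator S q - f q)))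
       + 3 * real (card V) * \<epsilon>\<^sup>2"
proof -
  define B where "B k = {p \<in> V. \<kappa> p = k}" for k
  define r where "r p = indicator S p - f p" for p
  have finB: "finite (B k)" for k
    using fin by (simp add: B_def)
  have r1: "(r p)\<^sup>2 \<le> 1" if "p \<in> V" for p
    using f01[OF that] by (auto simp: r_def indicator_def abs_square_le_1 split: if_splits)
  have group: "(\<Sum>k\<in>\<kappa> ` V. \<Sum>p\<in>B k. h p) = (\<Sum>p\<in>V. h p)" for h :: "'i \<Rightarrow> real"
    unfolding B_def using fin by (intro sum.group) auto
  have "(\<Sum>p\<in>V. (prop (A (\<kappa> p)) S - f p)\<^sup>2) = (\<Sum>k\<in>\<kappa> ` V. \<Sum>p\<in>B k. (prop (A k) S - f p)\<^sup>2)"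
    unfolding group[symmetric] by (simp add: B_def)
  also have "\<dots> \<le> (\<Sum>k\<in>\<kappa> ` V. (6 * D + 3)
      + 3 * (\<Sum>p\<in>B k. \<Sum>q\<in>V - {p}. same_bin_weight V \<kappa> p q * (r p * r q)) + 3 * \<epsilon>\<^sup>2 * (\<Sum>p\<in>B k. 1))"
  proof (rule sum_mono)
    fix k assume k: "k \<in> \<kappa> ` V"
    then have ne: "B k \<noteq> {}" and kK: "k \<in> K"
      using K by (auto simp: B_def)
    let ?N = "real (card (B k))"
    have N: "?N > 0"
      using ne finB by (simp add: card_gt_0_iff)
    have "(\<Sum>p\<in>B k. (prop (A k) S - f p)\<^sup>2)
      \<le> 6 * real (card ((A k - B k) \<union> (B k - A k))) + 3 / ?N * (\<Sum>p\<in>B k. r p)\<^sup>2 + 3 * ?N * \<epsilon>\<^sup>2"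
      unfolding prop_def r_def by (intro proportion_error finB ne fin kK) (auto simp: B_def intro!: f)
    moreover have "real (card ((A k - B k) \<union> (B k - A k))) \<le> D"
      using D[OF kK] by (simp add: B_def)
    \<comment> \<open>Each \<open>r p\<close> has square at most 1, so after the division by the
      size of the bin the diagonal costs at most 3.\<close>
    moreover have "3 / ?N * (\<Sum>p\<in>B k. r p)\<^sup>2
      \<le> 3 + 3 * (\<Sum>p\<in>B k. \<Sum>q\<in>V - {p}. same_bin_weight V \<kappa> p q * (r p * r q))"
    proof -
      have "(\<Sum>p\<in>B k. (r p)\<^sup>2) \<le> ?N"
        using sum_mono[of "B k" "\<lambda>p. (r p)\<^sup>2" "\<lambda>_. 1"] r1 by (simp add: B_def)
      then have "(\<Sum>p\<in>B k. (r p)\<^sup>2) / ?N \<le> 1"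
        using N by simp
      \<comment> \<open>The weight is zero for \<open>q\<close> outside the bin of \<open>p\<close>,
        so the inner sum may run over all of \<open>V - {p}\<close>.\<close>
      moreover have "(\<Sum>p\<in>B k. \<Sum>q\<in>B k - {p}. r p * r q) / ?N
        = (\<Sum>p\<in>B k. \<Sum>q\<in>V - {p}. same_bin_weight V \<kappa> p q * (r p * r q))"
        unfolding sum_divide_distrib
      proof (rule sum.cong[OF refl])
        fix p assume p: "p \<in> B k"
        have "(\<Sum>q\<in>B k - {p}. r p * r q / ?N) = (\<Sum>q\<in>{q \<in> V - {p}. \<kappa> q = k}. r p * r q / ?N)"
          by (intro sum.cong) (auto simp: B_def)
        also have "\<dots> = (\<Sum>q\<in>V - {p}. if \<kappa> q = k then r p * r q / ?N else 0)"
          using fin by (intro sum.inter_filter) auto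
        also have "\<dots> = (\<Sum>q\<in>V - {p}. same_bin_weight V \<kappa> p q * (r p * r q))"
          using p by (intro sum.cong) (auto simp: B_def same_bin_weight_def)
        finally show "(\<Sum>q\<in>B k - {p}. r p * r q / ?N) = \<dots>" .
      qed
      ultimately show ?thesis
        by (simp add: sum_square_split[OF finB] add_divide_distrib distrib_left)
    qed
    ultimately show "(\<Sum>p\<in>B k. (prop (A k) S - f p)\<^sup>2) \<le> (6 * D + 3)
      + 3 * (\<Sum>p\<in>B k. \<Sum>q\<in>V - {p}. same_bin_weight V \<kappa> p q * (r p * r q)) + 3 * \<epsilon>\<^sup>2 * (\<Sum>p\<in>B k. 1)"
      by (simp add: mult_ac)
  qed
  also have "\<dots> = real (card (\<kappa> ` V)) * (6 * D + 3)
      + 3 * (\<Sum>p\<in>V. \<Sum>q\<in>V - {p}. same_bin_weight V \<kappa> p q * (r p * r q)) + 3 * \<epsilon>\<^sup>2 * (\<Sum>p\<in>V. 1)"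
    by (simp only: sum.distrib group sum_distrib_left[symmetric]) (simp add: algebra_simps)
  also have "real (card (\<kappa> ` V)) * (6 * D + 3) \<le> real (card K) * (6 * D + 3)"
    using \<open>0 \<le> D\<close> K fin by (intro mult_right_mono) (auto intro: card_mono)
  finally show ?thesis
    by (simp add: r_def mult_ac)
qed

section \<open>Geometry of breakpoints and bins\<close>

text \<open>The index that \<open>fhat\<close> selects at \<open>x\<close>, in the same form, so
  that it can be folded into the definition of \<open>fhat\<close>.\<close>

definition bin :: "nat \<Rightarrow> (nat \<Rightarrow> real) \<Rightarrow> real \<Rightarrow> nat" where
  "bin b y x = (LEAST k. k \<in> {1..2 * b + 2} \<and> x \<in> {y k..y (Suc k)})"

text \<open>The support of the k-th breakpoint.\<close>

definition window :: "nat \<Rightarrow> nat \<Rightarrow> real set" where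
  "window b k = {grid_point b k - 1 / (4 * real b)..grid_point b k + 1 / (4 * real b)}"

text \<open>The centres are at least 1/b apart, while the two half-widths add up to only 1/(2b).
  This gives both the order of the breakpoints and the disjointness of the windows.\<close>

lemma window_less:
  assumes "b \<ge> 1" "i < j" "s \<in> window b i" "t \<in> window b j"
  shows "s < t"
proof -
  have "real i + 1 \<le> real j" using assms(2) by simp
  then have "grid_point b i + 1 / b \<le> grid_point b j"
    using assms(1) by (simp add: grid_point_def divide_simps)
  moreover have "1 / (4 * real b) + 1 / (4 * real b) < 1 / b"
    using assms(1) by (simp add: field_simps)
  ultimately show ?thesis
    using assms(3,4) by (auto simp: window_def)
qed

context
  fixes b :: nat and y :: "nat \<Rightarrow> real"
  assumes b: "b \<ge> 1" and y: "\<And>k. k \<in> {1..2 * b + 3} \<Longrightarrow> y k \<in> window b k"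
begin

lemma breakpoints_less:
  "i < j \<Longrightarrow> i \<in> {1..2 * b + 3} \<Longrightarrow> j \<in> {1..2 * b + 3} \<Longrightarrow> y i < y j"
  using window_less[OF b] y by blast

text \<open>Neighbouring centres are 1/b apart and each end may move by 1/(4b).\<close>

lemma breakpoint_gap:
  assumes "k \<in> {1..2 * b + 2}" shows "y (Suc k) - y k \<le> 3 / (2 * real b)"
proof -
  have "y k \<in> window b k" "y (Suc k) \<in> window b (Suc k)"
    using assms by (auto intro!: y)
  moreover have "grid_point b (Suc k) - grid_point b k = 1 / b"
    by (simp add: grid_point_def flip: diff_divide_distrib)
  moreover have "1 / real b + (1 / (4 * real b) + 1 / (4 * real b)) = 3 / (2 * real b)"
    using b by (simp add: field_simps)
  ultimately show ?thesis
    by (simp add: window_def)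
qed

lemma bin_mem:
  assumes x: "x \<in> {-1..1}"
  shows "bin b y x \<in> {1..2 * b + 2}" "x \<in> {y (bin b y x)..y (Suc (bin b y x))}"
proof -
  have "y 1 \<in> window b 1" "y (2 * b + 3) \<in> window b (2 * b + 3)"
    by (auto intro!: y)
  moreover have "grid_point b 1 = -1 - 1 / b" "grid_point b (2 * b + 3) = 1 + 1 / b"
    using b by (simp_all add: grid_point_def field_simps)
  moreover have "1 / (4 * real b) < 1 / b"
    using b by (simp add: field_simps)
  ultimately have 1: "y 1 < -1" and 2: "1 < y (2 * b + 3)"
    unfolding window_def atLeastAtMost_iff by linarith+
  \<comment> \<open>The first breakpoint at or above \<open>x\<close> is the right end of a bin
    containing \<open>x\<close>. It has a predecessor because \<open>y 1\<close> lies below -1. This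
    shows that the \<open>LEAST\<close> in \<open>bin\<close> is attained.\<close>
  define j where "j = (LEAST j. 1 \<le> j \<and> x \<le> y j)"
  have ex: "1 \<le> 2 * b + 3 \<and> x \<le> y (2 * b + 3)"
    using 2 x by simp
  have j: "1 \<le> j" "x \<le> y j" "j \<le> 2 * b + 3"
    using LeastI[of "\<lambda>j. 1 \<le> j \<and> x \<le> y j", OF ex] Least_le[of "\<lambda>j. 1 \<le> j \<and> x \<le> y j", OF ex]
    by (auto simp: j_def)
  have "j \<noteq> 1" using j(2) 1 x by auto
  then obtain i where i: "j = Suc i" "1 \<le> i"
    using j(1) by (cases j) auto
  have "\<not> x \<le> y i"
    using not_less_Least[of i "\<lambda>j. 1 \<le> j \<and> x \<le> y j", folded j_def] i by auto
  then have "i \<in> {1..2 * b + 2} \<and> x \<in> {y i..y (Suc i)}"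
    using i j by auto
  from LeastI[of "\<lambda>k. k \<in> {1..2 * b + 2} \<and> x \<in> {y k..y (Suc k)}", OF this]
  show "bin b y x \<in> {1..2 * b + 2}" "x \<in> {y (bin b y x)..y (Suc (bin b y x))}"
    by (auto simp: bin_def)
qed

text \<open>A move by at most \<open>\<delta>\<close> crosses no breakpoint if all of them are
  farther than \<open>\<delta>\<close> from \<open>x\<close>. The point then also avoids all
  breakpoints, so the closed intervals do not overlap at it.\<close>

lemma bin_stable:
  assumes x: "x \<in> {-1..1}" and k: "k \<in> {1..2 * b + 2}"
    and far: "\<And>k. k \<in> {1..2 * b + 3} \<Longrightarrow> \<bar>y k - x\<bar> > \<delta>" and h: "\<bar>h - x\<bar> \<le> \<delta>"
  shows "h \<in> {y k..y (Suc k)} \<longleftrightarrow> bin b y x = k"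
proof
  have f: "\<bar>y k - x\<bar> > \<delta>" "\<bar>y (Suc k) - x\<bar> > \<delta>"
    using k by (auto intro!: far)
  { assume "bin b y x = k"
    then show "h \<in> {y k..y (Suc k)}"
      using bin_mem[OF x] f h by auto }
  assume "h \<in> {y k..y (Suc k)}"
  then have x': "y k < x" "x < y (Suc k)"
    using f h by auto
  let ?j = "bin b y x"
  have "?j \<le> k"
    unfolding bin_def using k x' by (intro Least_le) auto
  \<comment> \<open>A smaller index would put the right end of the bin of \<open>x\<close> at or
    below \<open>y k\<close>, which is below \<open>x\<close>.\<close>
  moreover have "\<not> ?j < k"
  proof
    assume "?j < k"
    then have "y (Suc ?j) \<le> y k"
      using breakpoints_less[of "Suc ?j" k] k bin_mem[OF x] by (cases "Suc ?j = k") auto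
    then show False
      using bin_mem[OF x] x' by auto
  qed
  ultimately show "?j = k" by simp
qed

end

section \<open>Independence and the law of the breakpoints\<close>

text \<open>Grouping \<open>q\<close> with \<open>J\<close> makes the centred factor of
  \<open>p\<close> independent of everything else, so the mean of the product factors through
  zero.\<close>

lemma (in prob_space) centered_product:
  fixes Y :: "'s \<Rightarrow> 'a \<Rightarrow> real"
  assumes ind: "indep_vars (\<lambda>_. borel) Y K" and sub: "J \<subseteq> K" "p \<in> K" "q \<in> K" "p \<notin> J" "p \<noteq> q"
    and g [measurable]: "g \<in> borel_measurable (Pi\<^sub>M J (\<lambda>_. borel))" and gb: "\<And>z. \<bar>g z\<bar> \<le> 1"
    and Yb: "\<And>\<omega>. \<bar>Y p \<omega> - c\<bar> \<le> 1" "\<And>\<omega>. \<bar>Y q \<omega> - d\<bar> \<le> 1"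
    and E: "expectation (Y p) = c"
  shows "integrable M (\<lambda>\<omega>. g (\<lambda>k\<in>J. Y k \<omega>) * ((Y p \<omega> - c) * (Y q \<omega> - d)))" (is ?I)
    and "expectation (\<lambda>\<omega>. g (\<lambda>k\<in>J. Y k \<omega>) * ((Y p \<omega> - c) * (Y q \<omega> - d))) = 0" (is ?E)
proof -
  let ?J = "insert q J"
  have [measurable]: "k \<in> K \<Longrightarrow> random_variable borel (Y k)" for k
    using ind unfolding indep_vars_def by auto
  have [measurable]: "random_variable borel (Y p)" "random_variable borel (Y q)"
    using sub by auto
  have [measurable]: "(\<lambda>\<omega>. \<lambda>k\<in>J. Y k \<omega>) \<in> measurable M (Pi\<^sub>M J (\<lambda>_. borel))"
    using sub by (intro measurable_restrict) auto
  have *: "indep_var (Pi\<^sub>M {p} (\<lambda>_. borel)) (\<lambda>\<omega>. \<lambda>k\<in>{p}. Y k \<omega>)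
      (Pi\<^sub>M ?J (\<lambda>_. borel)) (\<lambda>\<omega>. \<lambda>k\<in>?J. Y k \<omega>)"
    using sub by (intro indep_var_restrict[OF ind]) auto
  have m1: "(\<lambda>z. z p - c) \<in> borel_measurable (Pi\<^sub>M {p} (\<lambda>_. borel))"
    by measurable
  have m2: "(\<lambda>z. g (restrict z J) * (z q - d)) \<in> borel_measurable (Pi\<^sub>M ?J (\<lambda>_. borel))"
  proof -
    have [measurable]: "(\<lambda>z. restrict z J) \<in> measurable (Pi\<^sub>M ?J (\<lambda>_. borel)) (Pi\<^sub>M J (\<lambda>_. borel :: real measure))"
      by (rule measurable_restrict_subset) auto
    have [measurable]: "(\<lambda>z. z q) \<in> borel_measurable (Pi\<^sub>M ?J (\<lambda>_. borel :: real measure))"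
      by (rule measurable_component_singleton) auto
    show ?thesis by measurable
  qed
  have "restrict (\<lambda>k\<in>?J. Y k \<omega>) J = (\<lambda>k\<in>J. Y k \<omega>)" for \<omega>
    by (auto simp: restrict_def)
  then have iv: "indep_var borel (\<lambda>\<omega>. Y p \<omega> - c) borel (\<lambda>\<omega>. g (\<lambda>k\<in>J. Y k \<omega>) * (Y q \<omega> - d))"
    using indep_var_compose[OF * m1 m2] by (simp add: comp_def)
  have i1: "integrable M (\<lambda>\<omega>. Y p \<omega> - c)"
    using Yb by (intro integrable_const_bound[where B = 1]) auto
  have i2: "integrable M (\<lambda>\<omega>. g (\<lambda>k\<in>J. Y k \<omega>) * (Y q \<omega> - d))"
    using gb Yb by (intro integrable_const_bound[where B = 1]) (auto simp: abs_mult intro!: mult_le_one)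
  \<comment> \<open>Adding \<open>c\<close> back gives the integrability of \<open>Y p\<close>,
    which the linearity of the expectation requires.\<close>
  have "integrable M (\<lambda>\<omega>. (Y p \<omega> - c) + c)"
    by (intro Bochner_Integration.integrable_add i1) auto
  then have "expectation (\<lambda>\<omega>. Y p \<omega> - c) = 0"
    using E by (simp add: prob_space)
  then show ?I ?E
    using indep_var_integrable[OF iv i1 i2] indep_var_lebesgue_integral[OF iv i1 i2]
    by (simp_all add: mult_ac)
qed

text \<open>The windows are disjoint, so together they cover no more than the interval around
  \<open>x\<close>. Bounding each term by \<open>2 * \<delta>\<close> would lose a factor of the
  number of windows.\<close>

lemma window_sum_measure:
  assumes "b \<ge> 1" "finite K" "\<delta> \<ge> 0"
  shows "(\<Sum>k\<in>K. measure lborel (window b k \<inter> {x - \<delta>..x + \<delta>})) \<le> 2 * \<delta>"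
proof -
  have "(\<Sum>k\<in>K. measure lborel (window b k \<inter> {x - \<delta>..x + \<delta>}))
      = measure lborel (\<Union>k\<in>K. window b k \<inter> {x - \<delta>..x + \<delta>})"
  proof (rule measure_finite_Union[symmetric])
    show "disjoint_family_on (\<lambda>k. window b k \<inter> {x - \<delta>..x + \<delta>}) K"
      unfolding disjoint_family_on_def using window_less[OF assms(1)]
      by (metis (no_types, lifting) Int_iff disjoint_iff less_irrefl linorder_neqE_nat)
  qed (use assms(2) in \<open>auto simp: window_def emeasure_lborel_Icc_eq Int_atLeastAtMost\<close>)
  also have "\<dots> \<le> measure lborel {x - \<delta>..x + \<delta>}"
    using assms by (intro measure_mono_fmeasurable) (auto simp: window_def fmeasurable_def intro!: sets.finite_UN)
  finally show ?thesis using assms by simp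
qed

text \<open>The factor 2b is the density on a window of length 1/(2b). The intersection is left
  unevaluated so that \<open>window_sum_measure\<close> can sum over \<open>k\<close>.\<close>

lemma (in prob_space) window_prob:
  assumes "b \<ge> 1" "random_variable borel Z"
    and "distr M borel Z = uniform_measure lborel (window b k)"
  shows "AE \<omega> in M. Z \<omega> \<in> window b k"
    and "\<P>(\<omega> in M. \<bar>Z \<omega> - x\<bar> \<le> \<delta>) = 2 * real b * measure lborel (window b k \<inter> {x - \<delta>..x + \<delta>})"
proof -
  have em: "emeasure lborel (window b k) = ennreal (1 / (2 * real b))"
    using assms(1) by (simp add: window_def field_simps)
  have s: "window b k \<in> sets lborel"
    by (simp add: window_def)
  have "AE x in uniform_measure lborel (window b k). x \<in> window b k"
    by (rule AE_uniform_measureI[OF s]) auto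
  then have "AE x in distr M borel Z. x \<in> window b k"
    unfolding assms(3) .
  then show "AE \<omega> in M. Z \<omega> \<in> window b k"
    using AE_distrD[OF assms(2)] by blast
  have "\<P>(\<omega> in M. \<bar>Z \<omega> - x\<bar> \<le> \<delta>) = measure (distr M borel Z) {x - \<delta>..x + \<delta>}"
    using assms(2) by (subst measure_distr) (auto intro!: arg_cong[where f = "measure M"])
  also have "\<dots> = measure lborel (window b k \<inter> {x - \<delta>..x + \<delta>}) / measure lborel (window b k)"
    unfolding assms(3) using em assms(1) by (intro measure_uniform_measure) auto
  also have "measure lborel (window b k) = 1 / (2 * real b)"
    using em assms(1) by (simp add: measure_def)
  finally show "\<P>(\<omega> in M. \<bar>Z \<omega> - x\<bar> \<le> \<delta>) = 2 * real b * measure lborel (window b k \<inter> {x - \<delta>..x + \<delta>})"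
    by simp
qed

section \<open>Measurability of bins and weights\<close>

lemma measurable_bin:
  assumes [measurable]: "\<And>k. k \<in> {1..2 * b + 3} \<Longrightarrow> (\<lambda>z. Z k z) \<in> borel_measurable N"
  shows "(\<lambda>z. bin b (\<lambda>k. Z k z) x) \<in> measurable N (count_space UNIV)"
  unfolding bin_def
proof (rule measurable_Least)
  fix k
  show "(\<lambda>z. k \<in> {1..2 * b + 2} \<and> x \<in> {Z k z..Z (Suc k) z}) \<in> measurable N (count_space UNIV)"
  proof (cases "k \<in> {1..2 * b + 2}")
    case True
    then have [measurable]: "(\<lambda>z. Z k z) \<in> borel_measurable N" "(\<lambda>z. Z (Suc k) z) \<in> borel_measurable N"
      by auto
    show ?thesis unfolding atLeastAtMost_iff by measurable
  qed simp
qed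

lemma measurable_same_bin_weight:
  assumes "finite V"
    and [measurable]: "\<And>p. (\<lambda>z. \<kappa> z p) \<in> measurable N (count_space UNIV)"
  shows "(\<lambda>z. same_bin_weight V (\<kappa> z) p q) \<in> borel_measurable N"
proof -
  \<comment> \<open>The cardinality of a varying set becomes a finite sum of indicators.\<close>
  have *: "real (card {r \<in> V. \<kappa> z r = \<kappa> z p}) = (\<Sum>r\<in>V. if \<kappa> z r = \<kappa> z p then 1 else 0)" for z
    using assms(1) by (simp add: sum.If_cases Int_def)
  have "(\<lambda>z. real (\<kappa> z p)) \<in> borel_measurable N" for p
    by (rule measurable_compose[OF assms(2)]) simp
  from borel_measurable_eq[OF this this]
  have [measurable]: "Measurable.pred N (\<lambda>z. \<kappa> z p = \<kappa> z q)" for p q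
    by (simp add: pred_def)
  show ?thesis
    unfolding same_bin_weight_def * by measurable
qed

text \<open>Allows the breakpoints to be replaced by a family restricted to their index set, as in
  \<open>centered_product\<close>.\<close>

lemma bin_cong:
  "(\<And>k. k \<in> {1..2 * b + 3} \<Longrightarrow> y k = y' k) \<Longrightarrow> bin b y x = bin b y' x"
  unfolding bin_def by (intro arg_cong[where f = Least] ext) auto

lemma same_bin_weight_le_1: "\<bar>same_bin_weight V \<kappa> p q\<bar> \<le> 1"
  by (cases "card {r \<in> V. \<kappa> r = \<kappa> p} = 0") (auto simp: same_bin_weight_def divide_simps simp del: card_eq_0_iff)

section \<open>The error for a single outcome\<close>

text \<open>Applies \<open>binned_error\<close> to the 2b + 2 bins. The number of bad positions is
  replaced by sums over positions, whose expectations follow by linearity.\<close>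

lemma fhat_error:
  fixes M H :: "nat \<Rightarrow> nat \<Rightarrow> real" and y :: "nat \<Rightarrow> real" and m n b :: nat
  defines "V \<equiv> idx m n"
  defines "\<kappa> \<equiv> \<lambda>p. bin b y (case_prod M p)"
  assumes b: "b \<ge> 1" and y: "\<And>k. k \<in> {1..2 * b + 3} \<Longrightarrow> y k \<in> window b k"
    and M: "\<And>p. p \<in> V \<Longrightarrow> case_prod M p \<in> {-1..1}"
    and f: "f \<in> {-1..1} \<rightarrow> {0..1}" and L: "L-lipschitz_on {-1..1} f" and \<delta>: "\<delta> > 0"
  shows "(\<Sum>p\<in>V. (fhat b m n y S H (case_prod M p) - f (case_prod M p))\<^sup>2)
    \<le> real (2 * b + 2) * (6 * ((\<Sum>p\<in>V. (case_prod H p - case_prod M p)\<^sup>2) / \<delta>\<^sup>2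
          + (\<Sum>p\<in>V. \<Sum>k\<in>{1..2 * b + 3}. if \<bar>y k - case_prod M p\<bar> \<le> \<delta> then 1 else 0)) + 3)
       + 3 * (\<Sum>p\<in>V. \<Sum>q\<in>V - {p}. same_bin_weight V \<kappa> p q
           * ((indicator S p - f (case_prod M p)) * (indicator S q - f (case_prod M q))))
       + 3 * real (card V) * (L * (3 / (2 * real b)))\<^sup>2"
proof -
  let ?\<mu> = "case_prod M" and ?h = "case_prod H"
  define K where "K = {1..2 * b + 2}"
  define A where "A k = {p \<in> V. ?h p \<in> {y k..y (Suc k)}}" for k
  define bad where "bad p \<longleftrightarrow> \<bar>?h p - ?\<mu> p\<bar> > \<delta> \<or> (\<exists>k\<in>{1..2 * b + 3}. \<bar>y k - ?\<mu> p\<bar> \<le> \<delta>)" for p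
  define D where "D = (\<Sum>p\<in>V. (?h p - ?\<mu> p)\<^sup>2) / \<delta>\<^sup>2
          + (\<Sum>p\<in>V. \<Sum>k\<in>{1..2 * b + 3}. if \<bar>y k - ?\<mu> p\<bar> \<le> \<delta> then 1 else 0)"
  have finV: "finite V"
    by (simp add: V_def idx_def)
  have bin: "\<kappa> p \<in> K" "?\<mu> p \<in> {y (\<kappa> p)..y (Suc (\<kappa> p))}" if "p \<in> V" for p
    using bin_mem[OF b y M[OF that]] by (simp_all add: \<kappa>_def K_def)
  have badD: "real (card {p \<in> V. bad p}) \<le> D"
  proof -
    have "real (card {p \<in> V. bad p}) = (\<Sum>p\<in>V. if bad p then 1 else 0)"
      using finV by (simp add: sum.If_cases Int_def)
    also have "\<dots> \<le> (\<Sum>p\<in>V. (?h p - ?\<mu> p)\<^sup>2 / \<delta>\<^sup>2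
        + (\<Sum>k\<in>{1..2 * b + 3}. if \<bar>y k - ?\<mu> p\<bar> \<le> \<delta> then 1 else 0))"
    proof (rule sum_mono)
      fix p
      let ?s = "\<Sum>k\<in>{1..2 * b + 3}. if \<bar>y k - ?\<mu> p\<bar> \<le> \<delta> then 1 else 0 :: real"
      have s0: "?s \<ge> 0"
        by (intro sum_nonneg) auto
      show "(if bad p then 1 else 0) \<le> (?h p - ?\<mu> p)\<^sup>2 / \<delta>\<^sup>2 + ?s"
      \<comment> \<open>A bad position is paid for by the squared error, as in the proof of the
        inequality of Markov, or else by one close breakpoint in \<open>?s\<close>.\<close>
      proof (cases "\<bar>?h p - ?\<mu> p\<bar> > \<delta>")
        case True
        then have "\<delta>\<^sup>2 \<le> (?h p - ?\<mu> p)\<^sup>2"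
          using \<delta> power_mono[of \<delta> "\<bar>?h p - ?\<mu> p\<bar>" 2] by simp
        then have "1 \<le> (?h p - ?\<mu> p)\<^sup>2 / \<delta>\<^sup>2"
          using \<delta> by simp
        then show ?thesis using s0 by auto
      next
        case False
        have "1 \<le> ?s" if k: "k \<in> {1..2 * b + 3}" "\<bar>y k - ?\<mu> p\<bar> \<le> \<delta>" for k
          using member_le_sum[of k "{1..2 * b + 3}" "\<lambda>k. if \<bar>y k - ?\<mu> p\<bar> \<le> \<delta> then 1 else 0 :: real"] k
          by auto
        then have "bad p \<Longrightarrow> 1 \<le> ?s"
          using False unfolding bad_def by blast
        moreover have "0 \<le> (?h p - ?\<mu> p)\<^sup>2 / \<delta>\<^sup>2" by simp
        ultimately show ?thesis using s0 by (simp only: split: if_split) linarith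
      qed
    qed
    finally show ?thesis
      by (simp add: D_def sum.distrib sum_divide_distrib)
  qed
  have fh: "fhat b m n y S H (?\<mu> p)
      = (if A (\<kappa> p) = {} then 0 else real (card (A (\<kappa> p) \<inter> S)) / real (card (A (\<kappa> p))))" for p
  proof -
    have "{(i, j) \<in> idx m n. H i j \<in> {y k..y (Suc k)}} = A k" for k
      by (auto simp: A_def V_def)
    then show ?thesis
      by (simp only: fhat_def revealed_proportion_def Let_def bin_def[symmetric] \<kappa>_def)
  qed
  have "(\<Sum>p\<in>V. ((if A (\<kappa> p) = {} then 0 else real (card (A (\<kappa> p) \<inter> S)) / real (card (A (\<kappa> p)))) - f (?\<mu> p))\<^sup>2)
    \<le> real (card K) * (6 * D + 3)
       + 3 * (\<Sum>p\<in>V. \<Sum>q\<in>V - {p}. same_bin_weight V \<kappa> p q * ((indicator S p - f (?\<mu> p)) * (indicator S q - f (?\<mu> q))))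
       + 3 * real (card V) * (L * (3 / (2 * real b)))\<^sup>2"
  proof (rule binned_error)
    show "\<kappa> ` V \<subseteq> K" using bin by auto
    show "0 \<le> D" using badD by linarith
    show "f (?\<mu> p) \<in> {0..1}" if "p \<in> V" for p
      using f M[OF that] by blast
    fix p q assume pq: "p \<in> V" "q \<in> V" "\<kappa> p = \<kappa> q"
    have "y (Suc (\<kappa> p)) - y (\<kappa> p) \<le> 3 / (2 * real b)"
      using breakpoint_gap[OF b y] bin(1)[OF pq(1)] by (simp add: K_def)
    then have "\<bar>?\<mu> p - ?\<mu> q\<bar> \<le> 3 / (2 * real b)"
      using bin(2)[OF pq(1)] bin(2)[OF pq(2)] pq(3) by auto
    moreover have "\<bar>f (?\<mu> p) - f (?\<mu> q)\<bar> \<le> L * \<bar>?\<mu> p - ?\<mu> q\<bar>"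
      using lipschitz_onD[OF L M[OF pq(1)] M[OF pq(2)]] by (simp add: dist_real_def)
    ultimately show "\<bar>f (?\<mu> p) - f (?\<mu> q)\<bar> \<le> L * (3 / (2 * real b))"
      using lipschitz_on_nonneg[OF L] by (meson mult_left_mono order_trans)
  next
    fix k assume k: "k \<in> K"
    \<comment> \<open>By \<open>bin_stable\<close>, a position that is not bad lies in the same bin
      under \<open>H\<close> and \<open>M\<close>. The bound is the same for every
      \<open>k\<close>.\<close>
    have "(A k - {p \<in> V. \<kappa> p = k}) \<union> ({p \<in> V. \<kappa> p = k} - A k) \<subseteq> {p \<in> V. bad p}"
    proof -
      have "?h p \<in> {y k..y (Suc k)} \<longleftrightarrow> \<kappa> p = k" if "p \<in> V" "\<not> bad p" for p
        unfolding \<kappa>_def using that k by (intro bin_stable[OF b y M, where \<delta> = \<delta>]) (auto simp: bad_def K_def not_le not_less)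
      then show ?thesis by (auto simp: A_def)
    qed
    then show "real (card ((A k - {p \<in> V. \<kappa> p = k}) \<union> ({p \<in> V. \<kappa> p = k} - A k))) \<le> D"
      using finV by (intro order_trans[OF of_nat_mono[OF card_mono] badD]) auto
  qed (use finV in \<open>auto simp: A_def K_def\<close>)
  then show ?thesis
    unfolding fh D_def[symmetric] by (simp add: K_def)
qed

section \<open>The expected error for a fixed tolerance\<close>

lemma expected_fhat_error:
  fixes m n b :: nat and M :: "nat \<Rightarrow> nat \<Rightarrow> real"
  defines "N \<equiv> real m * real n"
  assumes pos: "m \<ge> 1" "n \<ge> 1" "b \<ge> 1"
    and M: "\<forall>(i, j)\<in>idx m n. M i j \<in> {-1..1}"
    and f: "f \<in> {-1..1} \<rightarrow> {0..1}" and L: "L-lipschitz_on {-1..1} f"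
    and model: "sampling_model P m n b M f X Rev a U"
    and int: "\<forall>(i, j)\<in>idx m n. integrable P (\<lambda>\<omega>. (Mhat \<omega> i j - M i j)\<^sup>2)"
    and \<delta>: "\<delta> > 0"
  shows "(\<integral>\<omega>. (\<integral>x. (fhat b m n (\<lambda>k. a k \<omega>) {(i, j). \<omega> \<in> Rev i j} (Mhat \<omega>) x - f x)\<^sup>2
             \<partial>measure_pmf (empirical_dist m n M)) \<partial>P)
    \<le> 24 * real b * (MSE P m n M Mhat / \<delta>\<^sup>2 + 4 * real b * \<delta>) + 12 * real b / N + 7 * L\<^sup>2 / (real b)\<^sup>2"
proof -
  interpret prob_space P
    using model by (simp add: sampling_model_def)
  define V where "V = idx m n"
  define K where "K = {1..2 * b + 3}"
  let ?\<mu> = "case_prod M"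
  define Y where "Y = source_var X Rev a U"
  define S where "S \<omega> = {(i, j). \<omega> \<in> Rev i j}" for \<omega>
  define w where "w \<omega> p q = same_bin_weight V (\<lambda>p. bin b (\<lambda>k. a k \<omega>) (?\<mu> p)) p q" for \<omega> p q
  have V: "finite V" "card V = m * n" "V \<noteq> {}"
    using pos by (auto simp: V_def idx_def)
  have N: "N = real (card V)" "N > 0"
    using pos V by (simp_all add: N_def)
  have MV: "p \<in> V \<Longrightarrow> ?\<mu> p \<in> {-1..1}" for p
    using M by (auto simp: V_def)
  have ind: "indep_vars (\<lambda>_. borel) Y (sources m n b)"
    using model by (simp add: sampling_model_def Y_def)
  have rv: "s \<in> sources m n b \<Longrightarrow> random_variable borel (Y s)" for s
    using ind unfolding indep_vars_def by auto
  have Ybp: "Y (Breakpoint k) = a k" "Y (Reveal i j) = indicator (Rev i j)" for i j k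
    by (simp_all add: Y_def)
  have bp: "Breakpoint k \<in> sources m n b" if "k \<in> K" for k
    using that by (auto simp: sources_def K_def)
  have a: "random_variable borel (a k)" if "k \<in> K" for k
    using rv[OF bp[OF that]] by (simp add: Ybp)
  have da: "distr P borel (a k) = uniform_measure lborel (window b k)" if "k \<in> K" for k
    using model that by (simp add: sampling_model_def window_def K_def)
  \<comment> \<open>\<open>fhat_error\<close> is stated for breakpoints inside their windows, which
    holds only almost surely.\<close>
  have win: "AE \<omega> in P. \<forall>k\<in>K. a k \<omega> \<in> window b k"
    using window_prob(1)[OF pos(3) a da] by (subst AE_finite_all) (auto simp: K_def)

  \<comment> \<open>\<open>E1\<close>, \<open>E2\<close> and \<open>E3\<close> are the random terms
    in \<open>fhat_error\<close>: squared error, close breakpoints, cross terms.\<close>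
  define E1 where "E1 \<omega> = (\<Sum>p\<in>V. (case_prod (Mhat \<omega>) p - ?\<mu> p)\<^sup>2)" for \<omega>
  have i1: "integrable P E1"
    unfolding E1_def using int by (intro Bochner_Integration.integrable_sum) (auto simp: V_def)
  have e1: "expectation E1 = N * MSE P m n M Mhat"
  proof -
    have "E1 = (\<lambda>\<omega>. N * (1 / N * (\<Sum>i=1..m. \<Sum>j=1..n. (Mhat \<omega> i j - M i j)\<^sup>2)))"
      using N by (simp add: fun_eq_iff E1_def V_def idx_def sum.cartesian_product case_prod_unfold)
    then show ?thesis
      unfolding MSE_def N_def[symmetric] by (simp only: integral_mult_right_zero)
  qed

  define E2 where "E2 \<omega> = (\<Sum>p\<in>V. \<Sum>k\<in>K. indicator {\<omega> \<in> space P. \<bar>a k \<omega> - ?\<mu> p\<bar> \<le> \<delta>} \<omega> :: real)" for \<omega>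
  have ev: "{\<omega> \<in> space P. \<bar>a k \<omega> - ?\<mu> p\<bar> \<le> \<delta>} \<in> events" if "k \<in> K" for p k
  proof -
    note [measurable] = a[OF that]
    show ?thesis by measurable
  qed
  have i2: "integrable P E2"
    unfolding E2_def using ev by (intro Bochner_Integration.integrable_sum) (auto simp: emeasure_eq_measure)
  \<comment> \<open>For each position the density 2b meets a total length of at most
    \<open>2 * \<delta>\<close>.\<close>
  have e2: "expectation E2 \<le> N * (4 * real b * \<delta>)"
  proof -
    have "expectation E2 = (\<Sum>p\<in>V. \<Sum>k\<in>K. \<P>(\<omega> in P. \<bar>a k \<omega> - ?\<mu> p\<bar> \<le> \<delta>))"
      unfolding E2_def using ev
      by (subst Bochner_Integration.integral_sum; (intro Bochner_Integration.integrable_sum sum.cong refl)?)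
        (auto simp: emeasure_eq_measure intro!: sum.cong)
    also have "\<dots> = (\<Sum>p\<in>V. 2 * real b * (\<Sum>k\<in>K. measure lborel (window b k \<inter> {?\<mu> p - \<delta>..?\<mu> p + \<delta>})))"
      by (simp add: window_prob(2)[OF pos(3) a da] sum_distrib_left)
    also have "\<dots> \<le> (\<Sum>p\<in>V. 2 * real b * (2 * \<delta>))"
      using pos \<delta> by (intro sum_mono mult_left_mono window_sum_measure) (auto simp: K_def)
    finally show ?thesis by (simp add: N)
  qed

  define E3 where "E3 \<omega> = (\<Sum>p\<in>V. \<Sum>q\<in>V - {p}. w \<omega> p q
      * ((indicator (S \<omega>) p - f (?\<mu> p)) * (indicator (S \<omega>) q - f (?\<mu> q))))" for \<omega>
  \<comment> \<open>The weights depend on the breakpoints only, so the factor of \<open>p\<close> is independent of the rest.\<close>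
  have e3': "integrable P (\<lambda>\<omega>. w \<omega> p q * ((indicator (S \<omega>) p - f (?\<mu> p)) * (indicator (S \<omega>) q - f (?\<mu> q))))
      \<and> expectation (\<lambda>\<omega>. w \<omega> p q * ((indicator (S \<omega>) p - f (?\<mu> p)) * (indicator (S \<omega>) q - f (?\<mu> q)))) = 0"
    if pq: "p \<in> V" "q \<in> V - {p}" for p q
  proof -
    define R where "R p = case_prod Reveal p" for p
    define J where "J = Breakpoint ` K"
    define g where "g z = same_bin_weight V (\<lambda>p. bin b (\<lambda>k. z (Breakpoint k)) (?\<mu> p)) p q" for z :: "source \<Rightarrow> real"
    have YR: "Y (R p) \<omega> = indicator (S \<omega>) p" for p \<omega>
      by (cases p) (simp add: R_def Ybp S_def indicator_def)
    \<comment> \<open>Outside \<open>J\<close> the restricted family is \<open>undefined\<close>,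
      but \<open>bin\<close> reads only the breakpoints with index in \<open>K\<close>.\<close>
    have gw: "g (\<lambda>k\<in>J. Y k \<omega>) = w \<omega> p q" for \<omega>
      unfolding g_def w_def
      by (intro arg_cong[where f = "\<lambda>\<kappa>. same_bin_weight V \<kappa> p q"] ext bin_cong)
        (simp add: J_def K_def Ybp)
    have gm: "g \<in> borel_measurable (Pi\<^sub>M J (\<lambda>_. borel))"
      unfolding g_def
      by (intro measurable_same_bin_weight V measurable_bin measurable_component_singleton)
        (auto simp: J_def K_def)
    have Rs: "R p \<in> sources m n b" if "p \<in> V" for p
      using that by (cases p) (auto simp: R_def sources_def V_def)
    have dist: "R p \<noteq> R q" "R p \<notin> J"
      using pq by (cases p; cases q; auto simp: R_def J_def)+
    have "f (?\<mu> p) \<in> {0..1}" if "p \<in> V" for p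
      using f MV[OF that] by blast
    then have bd: "\<bar>Y (R p) \<omega> - f (?\<mu> p)\<bar> \<le> 1" if "p \<in> V" for p \<omega>
      using that by (fastforce simp: YR indicator_def)
    have E: "expectation (Y (R p)) = f (?\<mu> p)"
      using model pq by (cases p) (auto simp: R_def Ybp sampling_model_def V_def)
    have gb: "\<bar>g z\<bar> \<le> 1" for z
      by (simp add: g_def same_bin_weight_le_1)
    have J: "J \<subseteq> sources m n b"
      using bp by (auto simp: J_def)
    have q: "q \<in> V" using pq by simp
    show ?thesis
      using centered_product[OF ind J Rs[OF pq(1)] Rs[OF q] dist(2,1) gm gb bd[OF pq(1)] bd[OF q] E]
      unfolding gw YR by blast
  qed
  have i3: "integrable P E3"
    unfolding E3_def using e3' by (intro Bochner_Integration.integrable_sum) auto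
  have e3: "expectation E3 = 0"
    unfolding E3_def using e3'
    by (subst Bochner_Integration.integral_sum; (intro Bochner_Integration.integrable_sum)?)
      (auto intro!: sum.neutral simp: Bochner_Integration.integral_sum)

  define G where "G \<omega> = (real (2 * b + 2) * (6 * (E1 \<omega> / \<delta>\<^sup>2 + E2 \<omega>) + 3) + 3 * E3 \<omega>
      + 3 * N * (L * (3 / (2 * real b)))\<^sup>2) / N" for \<omega>
  have iG: "integrable P G"
    unfolding G_def using i1 i2 i3 by auto
  have eG: "expectation G = (real (2 * b + 2) * (6 * (expectation E1 / \<delta>\<^sup>2 + expectation E2) + 3)
      + 3 * N * (L * (3 / (2 * real b)))\<^sup>2) / N"
    unfolding G_def using i1 i2 i3 e3 by (simp add: prob_space)
  have inner: "(\<integral>x. h x \<partial>measure_pmf (empirical_dist m n M)) = (\<Sum>p\<in>V. h (?\<mu> p)) / N" for h :: "real \<Rightarrow> real"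
    using V N unfolding empirical_dist_def V_def[symmetric] by (simp add: integral_pmf_of_set)
  let ?F = "\<lambda>\<omega>. \<integral>x. (fhat b m n (\<lambda>k. a k \<omega>) (S \<omega>) (Mhat \<omega>) x - f x)\<^sup>2 \<partial>measure_pmf (empirical_dist m n M)"
  have FG: "AE \<omega> in P. ?F \<omega> \<le> G \<omega>"
    using win AE_space
  proof eventually_elim
    case (elim \<omega>)
    have "E2 \<omega> = (\<Sum>p\<in>V. \<Sum>k\<in>K. if \<bar>a k \<omega> - ?\<mu> p\<bar> \<le> \<delta> then 1 else 0)"
      unfolding E2_def using elim by (intro sum.cong refl) (auto simp: indicator_def)
    moreover have "(\<Sum>p\<in>V. (fhat b m n (\<lambda>k. a k \<omega>) (S \<omega>) (Mhat \<omega>) (?\<mu> p) - f (?\<mu> p))\<^sup>2)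
      \<le> real (2 * b + 2) * (6 * ((\<Sum>p\<in>V. (case_prod (Mhat \<omega>) p - ?\<mu> p)\<^sup>2) / \<delta>\<^sup>2
          + (\<Sum>p\<in>V. \<Sum>k\<in>K. if \<bar>a k \<omega> - ?\<mu> p\<bar> \<le> \<delta> then 1 else 0)) + 3)
       + 3 * E3 \<omega> + 3 * N * (L * (3 / (2 * real b)))\<^sup>2"
      unfolding E3_def w_def V_def K_def N(1)
      using elim MV by (intro fhat_error pos f L \<delta>) (auto simp: K_def V_def)
    ultimately have "(\<Sum>p\<in>V. (fhat b m n (\<lambda>k. a k \<omega>) (S \<omega>) (Mhat \<omega>) (?\<mu> p) - f (?\<mu> p))\<^sup>2) \<le> N * G \<omega>"
      using N by (simp add: G_def E1_def)
    then show ?case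
      unfolding inner using N by (simp add: divide_le_eq mult.commute)
  qed
  have "(\<integral>\<omega>. ?F \<omega> \<partial>P) \<le> expectation G"
    \<comment> \<open>This rule requires no measurability of the integrand on the left.\<close>
  proof (rule integral_mono_AE'[OF iG FG])
    have F0: "0 \<le> ?F \<omega>" for \<omega>
      by (rule Bochner_Integration.integral_nonneg) simp
    show "AE \<omega> in P. 0 \<le> G \<omega>"
      using FG by eventually_elim (rule order_trans[OF F0])
  qed
  also have "\<dots> \<le> (real (2 * b + 2) * (6 * (N * MSE P m n M Mhat / \<delta>\<^sup>2 + N * (4 * real b * \<delta>)) + 3)
      + 3 * N * (L * (3 / (2 * real b)))\<^sup>2) / N"
    unfolding eG e1 using e2 N by (intro divide_right_mono add_mono mult_left_mono) auto
  also have "\<dots> = 12 * (real b + 1) * (MSE P m n M Mhat / \<delta>\<^sup>2 + 4 * real b * \<delta>) + 6 * (real b + 1) / N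
      + 27 / 4 * L\<^sup>2 / (real b)\<^sup>2"
    using N pos \<delta> by (simp add: field_simps power2_eq_square)
  \<comment> \<open>Uses \<open>b + 1 \<le> 2 * b\<close> twice, and 27/4 < 7, where 27/4 is three
    times the square of 3/2.\<close>
  also have "\<dots> \<le> 24 * real b * (MSE P m n M Mhat / \<delta>\<^sup>2 + 4 * real b * \<delta>) + 12 * real b / N + 7 * L\<^sup>2 / (real b)\<^sup>2"
  proof -
    have "0 \<le> MSE P m n M Mhat"
      unfolding MSE_def by (intro Bochner_Integration.integral_nonneg mult_nonneg_nonneg sum_nonneg) auto
    then show ?thesis
      using N pos \<delta> by (intro add_mono mult_right_mono divide_right_mono) auto
  qed
  finally show ?thesis unfolding S_def .
qed

section \<open>Optimization over the tolerance\<close>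

theorem theorem2p7:
  "\<exists>C::real. C > 0 \<and>
    (\<forall>(m::nat) (n::nat) (b::nat) (M :: nat \<Rightarrow> nat \<Rightarrow> real) (f :: real \<Rightarrow> real) (L::real)
      (P :: (source \<Rightarrow> real) measure) X Rev a U T Mhat.
      m \<ge> 1 \<longrightarrow> n \<ge> 1 \<longrightarrow> b \<ge> 1 \<longrightarrow>
      (\<forall>(i, j)\<in>idx m n. M i j \<in> {-1..1}) \<longrightarrow>
      f \<in> {-1..1} \<rightarrow> {0..1} \<longrightarrow>
      L-lipschitz_on {-1..1} f \<longrightarrow>
      sampling_model P m n b M f X Rev a U \<longrightarrow>
      is_estimator m n T \<longrightarrow>
      Mhat = (\<lambda>\<omega>. T (observed m n X Rev \<omega>, U \<omega>)) \<longrightarrow>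
      (\<forall>(i, j)\<in>idx m n. integrable P (\<lambda>\<omega>. (Mhat \<omega> i j - M i j)\<^sup>2)) \<longrightarrow>
      (\<integral>\<omega>. (\<integral>x. (fhat b m n (\<lambda>k. a k \<omega>) {(i, j). \<omega> \<in> Rev i j} (Mhat \<omega>) x - f x)\<^sup>2
               \<partial>measure_pmf (empirical_dist m n M)) \<partial>P)
        \<le> C * MSE P m n M Mhat powr (1/3) * real b powr (5/3)
           + C * real b / (real m * real n) + C * L\<^sup>2 / (real b)\<^sup>2)"
proof (intro exI[of _ 120] conjI allI impI)
  fix m n b :: nat and M :: "nat \<Rightarrow> nat \<Rightarrow> real" and f L and P :: "(source \<Rightarrow> real) measure"
    and X Rev a U T Mhat
  assume pos: "m \<ge> 1" "n \<ge> 1" "b \<ge> 1"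
    and *: "\<forall>(i, j)\<in>idx m n. M i j \<in> {-1..1}" "f \<in> {-1..1} \<rightarrow> {0..1}" "L-lipschitz_on {-1..1} f"
      "sampling_model P m n b M f X Rev a U"
      "\<forall>(i, j)\<in>idx m n. integrable P (\<lambda>\<omega>. (Mhat \<omega> i j - M i j)\<^sup>2)"
  let ?I = "\<integral>\<omega>. (\<integral>x. (fhat b m n (\<lambda>k. a k \<omega>) {(i, j). \<omega> \<in> Rev i j} (Mhat \<omega>) x - f x)\<^sup>2
               \<partial>measure_pmf (empirical_dist m n M)) \<partial>P"
  define \<theta> where "\<theta> = MSE P m n M Mhat"
  let ?B = "12 * real b / (real m * real n) + 7 * L\<^sup>2 / (real b)\<^sup>2"
  have bound: "?I \<le> 24 * real b * (\<theta> / \<delta>\<^sup>2 + 4 * real b * \<delta>) + ?B" if "\<delta> > 0" for \<delta>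
    using expected_fhat_error[OF pos * that] by (simp add: \<theta>_def)
  have \<theta>: "\<theta> \<ge> 0"
    unfolding \<theta>_def MSE_def by (intro Bochner_Integration.integral_nonneg mult_nonneg_nonneg sum_nonneg) auto
  have "?I \<le> 120 * \<theta> powr (1/3) * real b powr (5/3) + ?B"
  \<comment> \<open>For \<open>\<theta> = 0\<close> the balancing tolerance would be 0, which
    \<open>bound\<close> excludes; instead \<open>\<delta>\<close> is taken arbitrarily small, with
    96 = 24 * 4 making the remaining term exactly \<open>e\<close>.\<close>
  proof (cases "\<theta> = 0")
    case True
    have "?I \<le> ?B + e" if "e > 0" for e
    proof -
      define \<delta> where "\<delta> = e / (96 * (real b)\<^sup>2)"
      have "\<delta> > 0" "24 * real b * (4 * real b * \<delta>) = e"
        using that pos by (simp_all add: \<delta>_def power2_eq_square)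
      then show ?thesis
        using bound[of \<delta>] True by simp
    qed
    then have "?I \<le> ?B" by (rule field_le_epsilon)
    then show ?thesis using True by simp
  next
    case False
    then have t: "\<theta> > 0" using \<theta> by simp
    have b: "real b > 0" using pos by simp
    \<comment> \<open>This choice balances \<open>\<theta> / \<delta>\<^sup>2\<close> against \<open>b * \<delta>\<close>.\<close>
    define \<delta> where "\<delta> = \<theta> powr (1/3) * real b powr (-1/3)"
    have "\<delta>\<^sup>2 = \<theta> powr (2/3) * real b powr (-2/3)"
      using t b by (simp add: \<delta>_def power_mult_distrib powr_powr flip: powr_realpow powr_numeral)
    moreover have "\<theta> / \<theta> powr (2/3) = \<theta> powr (1/3)"
      using t powr_diff[of \<theta> 1 "2/3"] by simp
    moreover have "1 / real b powr (-2/3) = real b powr (2/3)"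
      by (simp add: powr_minus_divide)
    ultimately have "\<theta> / \<delta>\<^sup>2 = \<theta> powr (1/3) * real b powr (2/3)"
      by (metis times_divide_times_eq mult.right_neutral)
    moreover have "real b * \<delta> = \<theta> powr (1/3) * real b powr (2/3)"
      using b powr_add[of "real b" 1 "-1/3"] by (simp add: \<delta>_def)
    \<comment> \<open>Both balanced quantities are equal, so the constant is 24 * (1 + 4) = 120; the
      outer factor \<open>b\<close> then raises the exponent 2/3 to 5/3.\<close>
    ultimately have "24 * real b * (\<theta> / \<delta>\<^sup>2 + 4 * real b * \<delta>) = 120 * \<theta> powr (1/3) * (real b * real b powr (2/3))"
      by (simp add: algebra_simps)
    also have "real b * real b powr (2/3) = real b powr (5/3)"
      using b powr_add[of "real b" 1 "2/3"] by simp
    finally show ?thesis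
      using bound[of \<delta>] t b by (simp add: \<delta>_def)
  qed
  moreover have "12 * real b / (real m * real n) \<le> 120 * real b / (real m * real n)"
      "7 * L\<^sup>2 / (real b)\<^sup>2 \<le> 120 * L\<^sup>2 / (real b)\<^sup>2"
    by (auto intro!: divide_right_mono mult_right_mono)
  ultimately show "?I \<le> 120 * MSE P m n M Mhat powr (1/3) * real b powr (5/3)
      + 120 * real b / (real m * real n) + 120 * L\<^sup>2 / (real b)\<^sup>2"
    by (simp add: \<theta>_def)
qed simp

end
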